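(* For all integers $q\ge 2$ and $N\ge 2$ there exists a $PHF(N;\,Nq^{N-1},\,q^{N-1}+(N-1)q^{N-2},\,N+1)$. Consequently, for every integer $t\ge 2$ and positive integers $w_1,\dots,w_t$ with $u=\sum_{i=1}^t w_i$, the number $u-1$ is the smallest real number $\gamma$ such that $C(u-1,q,\{w_1,\ldots,w_t\})\le \gamma q$ holds for all $q$.
   Context: An $(N;n,q)$-hash family is a set $\mathcal{F}$ of $N$ functions $f:X\to Y$ where $|X|=n$, $|Y|=q$. A function $f$ separates pairwise disjoint subsets $C_1,\dots,C_t\subseteq X$ if $f(C_1),\dots,f(C_t)$ are pairwise disjoint; $f$ separates a subset $C$ if $f$ is injective on $C$. A $PHF(N;n,q,t)$ ($t$-perfect hash family) is an $(N;n,q)$-hash family in which every $t$-element subset of $X$ is separated by some $f\in\mathcal{F}$. An $SHF(N;n,q,\{w_1,\ldots,w_t\})$ is an $(N;n,q)$-hash family such that for all pairwise disjoint $C_1,\dots,C_t\subseteq X$ with $|C_i|=w_i$ some $f\in\mathcal{F}$ separates $C_1,\dots,C_t$. $C(N,q,\{w_1,\ldots,w_t\})$ denotes the maximum $n$ for which an $SHF(N;n,q,\{w_1,\ldots,w_t\})$ exists. *)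

theory Defs
  imports "HOL-Library.FuncSet" "HOL-Library.Disjoint_Sets" Complex_Main
begin

text \<open>Extensional functions are used so that \<open>card F\<close> counts functions from \<open>X\<close> to \<open>Y\<close>,
  without regard to values outside \<open>X\<close>.\<close>

definition hash_family ::
    "nat \<Rightarrow> nat \<Rightarrow> nat \<Rightarrow> 'a set \<Rightarrow> 'b set \<Rightarrow> ('a \<Rightarrow> 'b) set \<Rightarrow> bool" where
  "hash_family N n q X Y F \<longleftrightarrow>
     finite X \<and> card X = n \<and> finite Y \<and> card Y = q \<and> F \<subseteq> X \<rightarrow>\<^sub>E Y \<and> card F = N"

definition separates_family :: "('a \<Rightarrow> 'b) \<Rightarrow> nat \<Rightarrow> (nat \<Rightarrow> 'a set) \<Rightarrow> bool" where
  "separates_family f t C \<longleftrightarrow> disjoint_family_on (\<lambda>i. f ` C i) {..<t}"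

definition separates_set :: "('a \<Rightarrow> 'b) \<Rightarrow> 'a set \<Rightarrow> bool" where
  "separates_set f C \<longleftrightarrow> inj_on f C"

definition PHF ::
    "nat \<Rightarrow> nat \<Rightarrow> nat \<Rightarrow> nat \<Rightarrow> 'a set \<Rightarrow> 'b set \<Rightarrow> ('a \<Rightarrow> 'b) set \<Rightarrow> bool" where
  "PHF N n q t X Y F \<longleftrightarrow>
     hash_family N n q X Y F \<and>
     (\<forall>C. C \<subseteq> X \<and> card C = t \<longrightarrow> (\<exists>f\<in>F. separates_set f C))"

text \<open>The type \<open>{w\<^sub>1, \<dots>, w\<^sub>t}\<close> is a multiset; it is given by the list \<open>ws\<close>, indexed from \<open>0\<close>.\<close>

definition SHF ::
    "nat \<Rightarrow> nat \<Rightarrow> nat \<Rightarrow> nat list \<Rightarrow> 'a set \<Rightarrow> 'b set \<Rightarrow> ('a \<Rightarrow> 'b) set \<Rightarrow> bool" where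
  "SHF N n q ws X Y F \<longleftrightarrow>
     hash_family N n q X Y F \<and>
     (\<forall>C. (\<forall>i<length ws. C i \<subseteq> X \<and> card (C i) = ws ! i) \<and>
          disjoint_family_on C {..<length ws} \<longrightarrow>
          (\<exists>f\<in>F. separates_family f (length ws) C))"

text \<open>Taking \<open>X\<close> and \<open>Y\<close> to be sets of naturals is no restriction, as only their sizes matter.
  For at least two positive weights with sum \<open>u\<close>, pigeonhole gives \<open>n \<le> (u - 1) * q ^ N\<close>
  whenever \<open>1 \<le> q\<close>; and \<open>n = u - 1\<close> is attained, vacuously, whenever \<open>N \<le> q ^ (u - 1)\<close>.
  So for \<open>N = u - 1\<close> and \<open>2 \<le> q\<close> the maximum exists.\<close>

definition max_SHF :: "nat \<Rightarrow> nat \<Rightarrow> nat list \<Rightarrow> nat" where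
  "max_SHF N q ws =
     Max {n. \<exists>(X :: nat set) (Y :: nat set) F. SHF N n q ws X Y F}"

end

theory Submission imports Defs begin

text \<open>
  Take as points the pairs \<open>(j, x)\<close> where \<open>j < N\<close> and \<open>x\<close> is a word over \<open>q\<close> letters whose
  positions are the indices different from \<open>j\<close>, and let the \<open>i\<close>-th function forget the letter at
  position \<open>i\<close>; it is injective on the block \<open>j = i\<close>. If every function fails to separate a set
  \<open>C\<close>, then merging along position \<open>0\<close>, then position \<open>1\<close>, and so on, loses a point each time and
  never joins two blocks, so \<open>C\<close> has at least \<open>N\<close> points more than the blocks it meets. With
  \<open>N + 1\<close> points \<open>C\<close> lies in one block, say \<open>j\<close>, which the \<open>j\<close>-th function separates.

  For the upper bound \<open>C(u - 1, q, {w\<^sub>1, \<dots>, w\<^sub>t}) \<le> (u - 1) q\<close>, set aside one representative of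
  every fibre of one of the functions (at most \<open>q\<close> points), find by induction a
  configuration that defeats the remaining functions in the other points, and add to it the
  representative of the fibre of one of its points, in a different class. Perfect hash families
  are separating, so the construction with \<open>N = u - 1\<close> and \<open>q \<rightarrow> \<infinity>\<close> shows that \<open>u - 1\<close> is optimal.
\<close>

section \<open>Forgetting coordinates\<close>

text \<open>The blank letter is \<open>undefined\<close>, the value of an extensional function off
  its domain, so \<open>forget j\<close> fixes every word that has no position
  \<open>j\<close>.\<close>

definition forget :: "'c \<Rightarrow> 'l \<times> ('c \<Rightarrow> 'v) \<Rightarrow> 'l \<times> ('c \<Rightarrow> 'v)" where
  "forget i p = (fst p, (snd p)(i := undefined))"

lemma fst_forget [simp]: "fst (forget i p) = fst p"
  by (simp add: forget_def)

lemma forget_commute: "forget i (forget j p) = forget j (forget i p)"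
  by (auto simp: forget_def)

text \<open>Agreement after forgetting \<open>i\<close> leaves only position \<open>i\<close> open,
  and that position survives forgetting \<open>j\<close>.\<close>

lemma forget_eq_imp_eq:
  assumes "i \<noteq> j" "forget i p = forget i r" "forget j p = forget j r"
  shows "p = r"
proof (rule prod_eqI)
  show "fst p = fst r"
    using assms(2) by (simp add: forget_def)
  have upd: "(snd p)(i := undefined) = (snd r)(i := undefined)"
    "(snd p)(j := undefined) = (snd r)(j := undefined)"
    using assms(2,3) by (simp_all add: forget_def)
  have "snd p k = snd r k" for k
    using fun_cong[OF upd(1), of k] fun_cong[OF upd(2), of k] assms(1)
    by (simp split: if_splits)
  then show "snd p = snd r" by blast
qed

text \<open>A form of Bondy's theorem on induced subsets, with labels.\<close>

lemma card_forget_not_inj_on: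
  assumes "finite S" "finite A" "\<And>i. i \<in> S \<Longrightarrow> \<not> inj_on (forget i) A"
  shows "card S + card (fst ` A) \<le> card A"
  using assms
proof (induction S arbitrary: A rule: finite_induct)
  case empty
  then show ?case by (simp add: card_image_le)
next
  case (insert i S)
  let ?B = "forget i ` A"
  \<comment> \<open>Two distinct points merged by \<open>forget j\<close> stay distinct under
    \<open>forget i\<close>, and by commutation \<open>forget j\<close> merges their images
    again.\<close>
  have "\<not> inj_on (forget j) ?B" if "j \<in> S" for j
  proof -
    obtain p r where pr: "p \<in> A" "r \<in> A" "p \<noteq> r" "forget j p = forget j r"
      using insert.prems(2) \<open>j \<in> S\<close> unfolding inj_on_def by blast
    have "i \<noteq> j" using insert.hyps \<open>j \<in> S\<close> by blast
    then have "forget i p \<noteq> forget i r"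
      using pr forget_eq_imp_eq by metis
    moreover have "forget j (forget i p) = forget j (forget i r)"
      using pr(4) by (metis forget_commute)
    ultimately show ?thesis
      using pr(1,2) unfolding inj_on_def by blast
  qed
  then have "card S + card (fst ` ?B) \<le> card ?B"
    using insert.IH[of ?B] insert.prems(1) by blast
  moreover have "fst ` ?B = fst ` A"
    by (simp add: image_image)
  moreover have "card ?B < card A"
    using insert.prems card_image_le[of A "forget i"] eq_card_imp_inj_on[of A "forget i"]
    by (meson insertI1 le_neq_implies_less)
  ultimately show ?case
    using insert.hyps by simp
qed

section \<open>The perfect hash family\<close>

text \<open>Moves a family on arbitrary points and values to the naturals. The values of each
  function are relabelled separately; \<open>ker\<close> keeps the functions distinct through this,
  so that their number is still \<open>N\<close>. A bound on the images suffices, since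
  \<open>{..<m}\<close> may contain spare values.\<close>

lemma ex_nat_PHF:
  fixes f :: "nat \<Rightarrow> 'a \<Rightarrow> 'b"
  assumes fin: "finite X" and cX: "card X = n"
    and cf: "\<And>i. i < N \<Longrightarrow> card (f i ` X) \<le> m"
    and ker: "\<And>i j. i < N \<Longrightarrow> j < N \<Longrightarrow> i \<noteq> j \<Longrightarrow>
                \<exists>x\<in>X. \<exists>y\<in>X. f i x = f i y \<and> f j x \<noteq> f j y"
    and sep: "\<And>C. C \<subseteq> X \<Longrightarrow> card C = t \<Longrightarrow> \<exists>i<N. inj_on (f i) C"
  shows "\<exists>(X :: nat set) (Y :: nat set) F. PHF N n m t X Y F"
proof -
  obtain h where h: "bij_betw h {..<n} X"
    using ex_bij_betw_nat_finite[OF fin] cX by (auto simp: atLeast0LessThan)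
  have "\<exists>e. inj_on e (f i ` X) \<and> e ` f i ` X \<subseteq> {..<m}" if "i < N" for i
    using cf[OF that] fin inj_on_iff_card_le[of "f i ` X" "{..<m}"] by auto
  then obtain e where e: "\<And>i. i < N \<Longrightarrow> inj_on (e i) (f i ` X)"
      "\<And>i. i < N \<Longrightarrow> e i ` f i ` X \<subseteq> {..<m}"
    by metis
  define g where "g i = restrict (\<lambda>x. e i (f i (h x))) {..<n}" for i
  have hX: "h x \<in> X" if "x < n" for x
    using h that by (auto simp: bij_betw_def)
  have g_eq: "g i x = g i y \<longleftrightarrow> f i (h x) = f i (h y)" if "i < N" "x < n" "y < n" for i x y
    using that hX e(1)[of i] by (auto simp: g_def inj_on_def)
  have "inj_on g {..<N}"
  proof (rule inj_onI, rule ccontr)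
    fix i j assume ij: "i \<in> {..<N}" "j \<in> {..<N}" "g i = g j" "i \<noteq> j"
    then obtain x y where "x \<in> X" "y \<in> X" "f i x = f i y" "f j x \<noteq> f j y"
      using ker[of i j] by auto
    moreover from this obtain a b where "a < n" "b < n" "x = h a" "y = h b"
      using h by (auto simp: bij_betw_def)
    ultimately show False
      using ij g_eq[of i a b] g_eq[of j a b] by auto
  qed
  moreover have "g ` {..<N} \<subseteq> {..<n} \<rightarrow>\<^sub>E {..<m}"
    using e(2) hX by (fastforce simp: g_def)
  moreover have "\<exists>k\<in>g ` {..<N}. inj_on k C" if C: "C \<subseteq> {..<n}" "card C = t" for C
  proof -
    have inj: "inj_on h C"
      using h C(1) by (auto simp: bij_betw_def intro: inj_on_subset)
    have "h ` C \<subseteq> X" "card (h ` C) = t"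
      using C hX card_image[OF inj] by auto
    then obtain i where i: "i < N" "inj_on (f i) (h ` C)"
      using sep by blast
    have "inj_on (g i) C"
    proof (rule inj_onI)
      fix x y assume "x \<in> C" "y \<in> C" "g i x = g i y"
      then show "x = y"
        using g_eq[of i x y] i C(1) inj by (auto simp: inj_on_def subset_iff)
    qed
    then show ?thesis using i(1) by blast
  qed
  ultimately have "PHF N n m t {..<n} {..<m} (g ` {..<N})"
    by (simp add: PHF_def hash_family_def separates_set_def card_image)
  then show ?thesis by blast
qed

lemma PHF_exists:
  assumes q: "2 \<le> q" and N: "2 \<le> N"
  shows "\<exists>(X :: nat set) (Y :: nat set) F.
           PHF N (N * q ^ (N - 1)) (q ^ (N - 1) + (N - 1) * q ^ (N - 2)) (N + 1) X Y F"
proof -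
  define W :: "nat set \<Rightarrow> (nat \<Rightarrow> nat) set" where "W J = J \<rightarrow>\<^sub>E {..<q}" for J
  define X where "X = (SIGMA j:{..<N}. W ({..<N} - {j}))"
  have finW: "finite (W J)" and cW: "card (W J) = q ^ card J" if "finite J" for J
    using that by (simp_all add: W_def finite_PiE card_PiE)
  have finX: "finite X"
    by (simp add: X_def finW)
  have cX: "card X = N * q ^ (N - 1)"
    by (simp add: X_def finW cW)
  have fixed: "forget j (j, x) = (j, x)" if "x \<in> W ({..<N} - {j})" for j x
    using that by (auto simp: forget_def W_def PiE_def extensional_def)
  show ?thesis
  proof (rule ex_nat_PHF[where f = forget, OF finX cX])
    fix i assume i: "i < N"
    \<comment> \<open>Block \<open>i\<close> keeps all its \<open>q ^ (N - 1)\<close> words, while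
      each of the other \<open>N - 1\<close> blocks loses a position and shrinks to
      \<open>q ^ (N - 2)\<close> words.\<close>
    define Z where "Z = ({i} \<times> W ({..<N} - {i})) \<union> (SIGMA j:{..<N} - {i}. W ({..<N} - {j} - {i}))"
    have "forget i ` X \<subseteq> Z"
    proof
      fix p assume "p \<in> forget i ` X"
      then obtain j x where jx: "j < N" "x \<in> W ({..<N} - {j})" "p = forget i (j, x)"
        by (auto simp: X_def)
      show "p \<in> Z"
      proof (cases "j = i")
        case True
        then show ?thesis using jx fixed by (simp add: Z_def)
      next
        case False
        then have "x(i := undefined) \<in> W ({..<N} - {j} - {i})"
          using jx(2) by (auto simp: W_def PiE_def extensional_def Pi_def)
        then show ?thesis using jx False by (simp add: Z_def forget_def)
      qed
    qed
    moreover have "finite Z"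
      by (simp add: Z_def finW)
    ultimately have "card (forget i ` X) \<le> card Z"
      by (rule card_mono[rotated])
    also have "\<dots> \<le> card ({i} \<times> W ({..<N} - {i})) + card (SIGMA j:{..<N} - {i}. W ({..<N} - {j} - {i}))"
      unfolding Z_def by (rule card_Un_le)
    also have "card ({i} \<times> W ({..<N} - {i})) = q ^ (N - 1)"
      using i by (simp add: cW card_cartesian_product)
    also have "card (SIGMA j:{..<N} - {i}. W ({..<N} - {j} - {i})) = (\<Sum>j\<in>{..<N} - {i}. q ^ (N - 2))"
      using i by (subst card_SigmaI) (auto simp: finW cW card_Diff_singleton_if numeral_2_eq_2 intro!: sum.cong)
    also have "\<dots> = (N - 1) * q ^ (N - 2)"
      using i by simp
    finally show "card (forget i ` X) \<le> q ^ (N - 1) + (N - 1) * q ^ (N - 2)"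
      by simp
  next
    fix i j assume ij: "i < N" "j < N" "i \<noteq> j"
    \<comment> \<open>Two words of block \<open>j\<close> that differ only at position
      \<open>i\<close> are merged by \<open>forget i\<close> and left alone by
      \<open>forget j\<close>. The letter \<open>1\<close> is available because
      \<open>2 \<le> q\<close>.\<close>
    define x where "x = restrict (\<lambda>_. 0::nat) ({..<N} - {j})"
    have x: "x \<in> W ({..<N} - {j})" and y: "x(i := 1) \<in> W ({..<N} - {j})"
      using ij q by (auto simp: x_def W_def PiE_def extensional_def)
    have "x i \<noteq> (x(i := 1)) i"
      using ij by (simp add: x_def)
    then have "x \<noteq> x(i := 1)" by metis
    then have "forget j (j, x) \<noteq> forget j (j, x(i := 1))"
      using fixed[OF x] fixed[OF y] by simp
    moreover have "forget i (j, x) = forget i (j, x(i := 1))"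
      by (simp add: forget_def)
    moreover have "(j, x) \<in> X" "(j, x(i := 1)) \<in> X"
      using x y ij by (simp_all add: X_def)
    ultimately show "\<exists>x\<in>X. \<exists>y\<in>X. forget i x = forget i y \<and> forget j x \<noteq> forget j y"
      by blast
  next
    fix C assume C: "C \<subseteq> X" "card C = N + 1"
    show "\<exists>i<N. inj_on (forget i) C"
    proof (rule ccontr)
      assume contr: "\<not> ?thesis"
      have finC: "finite C" using C(1) finX finite_subset by blast
      have "card {..<N} + card (fst ` C) \<le> card C"
        using contr finC by (intro card_forget_not_inj_on) auto
      then have "card (fst ` C) \<le> 1"
        using C(2) by simp
      moreover have "C \<noteq> {}"
        using C(2) by auto
      ultimately obtain j where j: "fst ` C = {j}"
        using finC by (metis One_nat_def card_1_singletonE card_gt_0_iff finite_imageI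
            image_is_empty le_antisym Suc_leI)
      have "forget j p = p" if "p \<in> C" for p
      proof -
        have "fst p = j" using j that by auto
        moreover have "p \<in> X" using that C(1) by blast
        ultimately show ?thesis using fixed[of "snd p" j] by (auto simp: X_def)
      qed
      then have "inj_on (forget j) C"
        by (simp add: inj_on_def)
      moreover have "j < N"
        using image_mono[OF C(1), of fst] j by (auto simp: X_def)
      ultimately show False using contr by blast
    qed
  qed
qed

section \<open>Separating hash families\<close>

text \<open>Disjoint classes of the given sizes have a union of exactly \<open>sum_list ws\<close>
  points, and a function injective on the union keeps their images disjoint.\<close>

lemma PHF_imp_SHF:
  assumes "PHF N n q (sum_list ws) X Y F"
  shows "SHF N n q ws X Y F"
  unfolding SHF_def
proof (intro conjI allI impI)
  show "hash_family N n q X Y F"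
    using assms by (simp add: PHF_def)
  then have finX: "finite X" by (simp add: hash_family_def)
  fix C
  assume C: "(\<forall>i<length ws. C i \<subseteq> X \<and> card (C i) = ws ! i) \<and> disjoint_family_on C {..<length ws}"
  let ?U = "\<Union>i<length ws. C i"
  have "card ?U = (\<Sum>i<length ws. card (C i))"
    using C finX by (intro card_UN_disjoint') (auto intro: finite_subset)
  also have "\<dots> = sum_list ws"
    using C by (simp add: sum_list_sum_nth atLeast0LessThan)
  finally have "card ?U = sum_list ws" .
  moreover have "?U \<subseteq> X" using C by blast
  ultimately obtain f where "f \<in> F" "inj_on f ?U"
    using assms unfolding PHF_def separates_set_def by blast
  moreover have "separates_family f (length ws) C"
    unfolding separates_family_def disjoint_family_on_def
  proof (intro ballI impI)
    fix i j assume ij: "i \<in> {..<length ws}" "j \<in> {..<length ws}" "i \<noteq> j"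
    then have "C i \<inter> C j = {}"
      using C by (auto simp: disjoint_family_on_def)
    then show "f ` C i \<inter> f ` C j = {}"
      using \<open>inj_on f ?U\<close> ij inj_on_image_Int[of f ?U "C i" "C j"] by blast
  qed
  ultimately show "\<exists>f\<in>F. separates_family f (length ws) C" by blast
qed

text \<open>Shaped for the induction: each function costs at most \<open>q\<close> points and one
  unit of weight, and the unit in \<open>+ 1\<close> is the point left at the end. Zero weights are
  allowed because weights are used up on the way.\<close>

lemma ex_unseparated_classes:
  fixes w :: "nat \<Rightarrow> nat"
  assumes "finite F" "finite X" "card F * q < card X" "\<And>f. f \<in> F \<Longrightarrow> card (f ` X) \<le> q"
    and "2 \<le> t" "sum w {..<t} = card F + 1" "0 < w 0" "F \<noteq> {} \<Longrightarrow> 0 < w 1"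
  shows "\<exists>C. (\<forall>i<t. C i \<subseteq> X \<and> card (C i) = w i) \<and> disjoint_family_on C {..<t} \<and>
             (\<forall>f\<in>F. \<not> separates_family f t C)"
  using assms
proof (induction F arbitrary: X w rule: finite_induct)
  case empty
  \<comment> \<open>With no function left the total weight is \<open>1\<close> and lies in class
    \<open>0\<close>, so any one point will do.\<close>
  obtain x where "x \<in> X"
    using empty.prems(2) by fastforce
  have "sum w {..<t} = w 0 + sum w ({..<t} - {0})"
    using empty.prems(4) by (intro sum.remove) auto
  then have "w 0 = 1" "sum w ({..<t} - {0}) = 0"
    using empty.prems(5,6) unfolding card.empty by linarith+
  moreover from this(2) have "w i = 0" if "i < t" "i \<noteq> 0" for i
    using that by (simp only: sum_eq_0_iff finite_Diff finite_lessThan) blast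
  ultimately show ?case
    using \<open>x \<in> X\<close>
    by (intro exI[of _ "\<lambda>i. if i = 0 then {x} else {}"]) (auto simp: disjoint_family_on_def)
next
  case (insert f F)
  \<comment> \<open>Classes \<open>0\<close> and \<open>1\<close> stay nonempty while functions remain, so the added point can avoid the class
    of a point already chosen.\<close>
  obtain i where i: "i < t" "0 < w i" "i = 0 \<Longrightarrow> 2 \<le> w 0" "i = 1 \<Longrightarrow> F \<noteq> {} \<Longrightarrow> 2 \<le> w 1"
  proof -
    have "\<exists>i<t. 0 < w i \<and> (i = 0 \<longrightarrow> 2 \<le> w 0) \<and> (i = 1 \<longrightarrow> F \<noteq> {} \<longrightarrow> 2 \<le> w 1)"
    proof (rule ccontr)
      assume no: "\<not> ?thesis"
      then have "w 0 = 1" "w 1 = 1" "F \<noteq> {}"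
        using no[unfolded not_ex, rule_format, of 0] no[unfolded not_ex, rule_format, of 1] insert.prems(4,6,7)
        by auto
      moreover have "w i = 0" if "i < t" "i \<notin> {0, 1}" for i
        using no that by auto
      \<comment> \<open>The total would be \<open>2\<close>, whereas it is \<open>card F + 2\<close>
        with \<open>F\<close> nonempty.\<close>
      then have "sum w {..<t} = sum w {0, 1}"
        using insert.prems(4) by (intro sum.mono_neutral_right) auto
      ultimately show False
        using insert.prems(5) insert.hyps by simp
    qed
    then show ?thesis using that by blast
  qed
  \<comment> \<open>Class \<open>j\<close> differs from \<open>i\<close> and is still nonempty under
    the reduced weights \<open>v\<close>; the unit taken from class \<open>i\<close> is reserved for
    the representative added last.\<close>
  define j :: nat where "j = (if i = 0 then 1 else 0)"
  define v where "v = w(i := w i - 1)"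
  have j: "j < t" "j \<noteq> i" "0 < v j"
    using insert.prems(4,6,7) by (auto simp: j_def v_def)
  define R where "R = inv_into X f ` f ` X"
  have R: "R \<subseteq> X" "card R \<le> q"
    using insert.prems(3)[of f] card_image_le[of "f ` X" "inv_into X f"] insert.prems(1)
    by (auto simp: R_def inv_into_into)
  have "card F * q < card (X - R)"
    using insert.prems(1,2) insert.hyps R by (simp add: card_Diff_subset finite_subset)
  moreover have "card (g ` (X - R)) \<le> q" if "g \<in> F" for g
    using insert.prems(1) insert.prems(3)[of g] that card_mono[of "g ` X" "g ` (X - R)"] by fastforce
  moreover have "sum v {..<t} = card F + 1"
  proof -
    have "sum v ({..<t} - {i}) = sum w ({..<t} - {i})"
      by (simp add: v_def)
    then show ?thesis
      using sum.remove[of "{..<t}" i v] sum.remove[of "{..<t}" i w] i insert.prems(5) insert.hyps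
      by (simp add: v_def)
  qed
  moreover have "0 < v 0" "F \<noteq> {} \<Longrightarrow> 0 < v 1"
    using i insert.prems(6,7) by (auto simp: v_def)
  ultimately have "\<exists>C. (\<forall>k<t. C k \<subseteq> X - R \<and> card (C k) = v k) \<and> disjoint_family_on C {..<t} \<and>
      (\<forall>g\<in>F. \<not> separates_family g t C)"
    using insert.prems(1,4) by (intro insert.IH) auto
  then obtain D where D: "\<And>k. k < t \<Longrightarrow> D k \<subseteq> X - R" "\<And>k. k < t \<Longrightarrow> card (D k) = v k"
      "disjoint_family_on D {..<t}" "\<And>g. g \<in> F \<Longrightarrow> \<not> separates_family g t D"
    by blast
  obtain x where x: "x \<in> D j"
    using D(2)[OF j(1)] j(3) by fastforce
  \<comment> \<open>Since \<open>D\<close> avoids \<open>R\<close>, the representative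
    \<open>r\<close> is a new point: class \<open>i\<close> grows by exactly one and the classes
    stay disjoint.\<close>
  define r where "r = inv_into X f (f x)"
  have xX: "x \<in> X" using x D(1)[OF j(1)] by blast
  have r: "r \<in> R" "f r = f x"
    using xX by (auto simp: r_def R_def f_inv_into_f)
  define C where "C = D(i := insert r (D i))"
  have rD: "r \<notin> D k" if "k < t" for k
    using D(1)[OF that] r(1) by blast
  have "C k \<subseteq> X \<and> card (C k) = w k" if "k < t" for k
  proof -
    have "finite (D k)" using D(1)[OF that] insert.prems(1) finite_subset by blast
    then show ?thesis
      using D(1,2)[OF that] rD[OF that] r(1) R(1) i(2) by (auto simp: C_def v_def)
  qed
  moreover have "disjoint_family_on C {..<t}"
    using D(3) rD by (auto simp: C_def disjoint_family_on_def)
  moreover have "\<not> separates_family g t C" if "g \<in> insert f F" for g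
  proof (cases "g = f")
    case True
    have "f x \<in> f ` C j \<inter> f ` C i"
      using x r(2) j by (auto simp: C_def intro: rev_image_eqI)
    then show ?thesis
      using True i(1) j unfolding separates_family_def disjoint_family_on_def by blast
  next
    case False
    then have "\<not> separates_family g t D" using D(4) that by blast
    \<comment> \<open>Larger classes have larger images, so the overlap that defeats
      \<open>g\<close> persists.\<close>
    moreover have "D k \<subseteq> C k" for k by (auto simp: C_def)
    ultimately show ?thesis
      unfolding separates_family_def disjoint_family_on_def by blast
  qed
  ultimately show ?case by blast
qed

lemma length_le_sum_list:
  fixes ws :: "nat list"
  assumes "\<forall>w\<in>set ws. 0 < w"
  shows "length ws \<le> sum_list ws"
  using assms by (induction ws) auto

text \<open>Any larger \<open>n\<close> leaves enough points for
  \<open>ex_unseparated_classes\<close> to defeat all \<open>sum_list ws - 1\<close> functions at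
  once.\<close>

lemma SHF_card_le:
  assumes S: "SHF (sum_list ws - 1) n q ws X Y F"
    and ws: "2 \<le> length ws" "\<forall>w\<in>set ws. 0 < w"
  shows "n \<le> (sum_list ws - 1) * q"
proof (rule ccontr)
  assume n: "\<not> ?thesis"
  have H: "finite X" "card X = n" "finite Y" "card Y = q" "F \<subseteq> X \<rightarrow>\<^sub>E Y" "card F = sum_list ws - 1"
    using S by (auto simp: SHF_def hash_family_def)
  have "finite F"
    using H by (meson finite_PiE finite_subset)
  moreover have "card F * q < card X"
    using n H by simp
  moreover have "card (f ` X) \<le> q" if "f \<in> F" for f
    using H that card_mono[of Y "f ` X"] by blast
  moreover have pos: "0 < ws ! k" if "k < 2" for k
    by (intro bspec[OF ws(2)] nth_mem order.strict_trans2[OF that ws(1)])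
  moreover have "sum ((!) ws) {..<length ws} = card F + 1"
    using H(6) length_le_sum_list[OF ws(2)] ws(1)
    by (simp add: sum_list_sum_nth atLeast0LessThan)
  ultimately obtain C where "\<forall>i<length ws. C i \<subseteq> X \<and> card (C i) = ws ! i"
      "disjoint_family_on C {..<length ws}" "\<forall>f\<in>F. \<not> separates_family f (length ws) C"
    using ex_unseparated_classes[of F X q "length ws" "(!) ws"] H(1) ws(1) by auto
  then show False
    using S unfolding SHF_def by blast
qed

text \<open>Supplies a member of the set whose \<open>Max\<close> is taken. With fewer points than
  the total weight there are no classes to separate, so any \<open>N\<close> distinct functions
  serve, and they exist because \<open>N \<le> 2 ^ N \<le> q ^ N\<close>.\<close>

lemma SHF_vacuous:
  assumes q: "2 \<le> q" and u: "0 < sum_list ws"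
  shows "\<exists>(X :: nat set) (Y :: nat set) F.
           SHF (sum_list ws - 1) (sum_list ws - 1) q ws X Y F"
proof -
  define N where "N = sum_list ws - 1"
  have "N \<le> 2 ^ N" by (simp add: less_imp_le)
  also have "\<dots> \<le> q ^ N" using q by (simp add: power_mono)
  also have "\<dots> = card ({..<N} \<rightarrow>\<^sub>E {..<q})" by (simp add: card_PiE)
  finally obtain F where F: "F \<subseteq> {..<N} \<rightarrow>\<^sub>E {..<q}" "card F = N"
    using obtain_subset_with_card_n by metis
  have "\<not> (C \<subseteq> {..<N} \<and> card C = sum_list ws)" for C
    using card_mono[of "{..<N}" C] u by (auto simp: N_def)
  then have "PHF N N q (sum_list ws) {..<N} {..<q} F"
    using F by (auto simp: PHF_def hash_family_def)
  then show ?thesis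
    unfolding N_def using PHF_imp_SHF by blast
qed

text \<open>Covers total weight \<open>2\<close>, that is a single function, where the construction
  for \<open>2 \<le> N\<close> does not apply.\<close>

lemma PHF_identity: "PHF 1 n n t {..<n} {..<n} {restrict id {..<n}}"
  by (auto simp: PHF_def hash_family_def separates_set_def inj_on_def)

section \<open>The maximum size and its optimal linear bound\<close>

lemma finite_SHF_sizes:
  assumes "2 \<le> length ws" "\<forall>w\<in>set ws. 0 < w"
  shows "finite {n. \<exists>(X :: nat set) (Y :: nat set) F. SHF (sum_list ws - 1) n q ws X Y F}"
  using SHF_card_le[OF _ assms]
  by (intro finite_subset[OF _ finite_atMost[of "(sum_list ws - 1) * q"]]) auto

lemma le_max_SHF:
  fixes X Y :: "nat set"
  assumes "2 \<le> length ws" "\<forall>w\<in>set ws. 0 < w"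
    and "SHF (sum_list ws - 1) n q ws X Y F"
  shows "n \<le> max_SHF (sum_list ws - 1) q ws"
  unfolding max_SHF_def using assms(3) by (intro Max_ge finite_SHF_sizes assms(1,2)) auto

lemma max_SHF_le:
  assumes ws: "2 \<le> length ws" "\<forall>w\<in>set ws. 0 < w" and q: "2 \<le> q"
  shows "max_SHF (sum_list ws - 1) q ws \<le> (sum_list ws - 1) * q"
proof -
  have "0 < sum_list ws" using length_le_sum_list[OF ws(2)] ws(1) by linarith
  then have "{n. \<exists>(X :: nat set) (Y :: nat set) F. SHF (sum_list ws - 1) n q ws X Y F} \<noteq> {}"
    using SHF_vacuous[OF q] by blast
  then show ?thesis
    unfolding max_SHF_def
    using SHF_card_le[OF _ ws] by (subst Max_le_iff[OF finite_SHF_sizes[OF ws]]) auto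
qed

text \<open>The constructed families have \<open>N * q ^ (N - 1)\<close> points and
  \<open>q ^ (N - 1) * (1 + (N - 1) / q)\<close> values, a ratio that tends to \<open>N\<close> as
  \<open>q\<close> grows.\<close>

lemma max_SHF_ratio_ge:
  fixes \<gamma> :: real
  assumes ws: "2 \<le> length ws" "\<forall>w\<in>set ws. 0 < w"
    and bound: "\<And>q. 2 \<le> q \<Longrightarrow> real (max_SHF (sum_list ws - 1) q ws) \<le> \<gamma> * real q"
  shows "real (sum_list ws - 1) \<le> \<gamma>"
proof -
  define N where "N = sum_list ws - 1"
  have N: "1 \<le> N" "sum_list ws = N + 1"
    using length_le_sum_list[OF ws(2)] ws(1) by (auto simp: N_def)
  show ?thesis
  proof (cases "N = 1")
    \<comment> \<open>The identity on two points gives \<open>2 \<le> \<gamma> * 2\<close>.\<close>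
    case True
    have "SHF N 2 2 ws {..<2 :: nat} {..<2 :: nat} {restrict id {..<2}}"
      using PHF_imp_SHF[OF PHF_identity] True by metis
    then have "2 \<le> max_SHF N 2 ws"
      using le_max_SHF[OF ws] by (simp add: N_def)
    then show ?thesis
      using bound[of 2] True by (simp add: N_def)
  next
    case False
    then have N2: "2 \<le> N" using N by simp
    have main: "real N \<le> \<gamma> * (1 + (real N - 1) / real q)" if q: "2 \<le> q" for q
    proof -
      \<comment> \<open>Here \<open>q\<close> is the number of letters of the words; the hypothesis
        on \<open>\<gamma>\<close> is applied to \<open>Q\<close>, the number of values of the
        functions.\<close>
      define Q where "Q = q ^ (N - 1) + (N - 1) * q ^ (N - 2)"
      have "q ^ 1 \<le> q ^ (N - 1)"
        using q N2 by (intro power_increasing) auto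
      then have Q: "2 \<le> Q" using q by (simp add: Q_def)
      obtain X Y :: "nat set" and F where "PHF N (N * q ^ (N - 1)) Q (N + 1) X Y F"
        using PHF_exists[OF q N2] unfolding Q_def by blast
      then have "SHF N (N * q ^ (N - 1)) Q ws X Y F"
        using PHF_imp_SHF N(2) by metis
      then have "N * q ^ (N - 1) \<le> max_SHF N Q ws"
        using le_max_SHF[OF ws] by (simp add: N_def)
      then have "real (N * q ^ (N - 1)) \<le> \<gamma> * real Q"
        using bound[OF Q] unfolding N_def by linarith
      moreover have "real Q = (1 + (real N - 1) / real q) * real q ^ (N - 1)"
      proof -
        have "real q ^ (N - 1) = real q * real q ^ (N - 2)"
          using N2 by (metis Suc_1 Suc_diff_le Suc_le_lessD diff_Suc_Suc power_Suc Suc_diff_Suc)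
        then show ?thesis
          using q N2 by (simp add: Q_def field_simps of_nat_diff)
      qed
      ultimately have "real N * real q ^ (N - 1) \<le> \<gamma> * (1 + (real N - 1) / real q) * real q ^ (N - 1)"
        by (simp add: mult.assoc)
      then show ?thesis
        using q by (subst (asm) mult_le_cancel_right_pos) auto
    qed
    have "(\<lambda>q. \<gamma> * (1 + (real N - 1) / real q)) \<longlonglongrightarrow> \<gamma> * (1 + 0)"
      by (intro tendsto_intros lim_const_over_n)
    then have "real N \<le> \<gamma> * (1 + 0)"
      using main by (intro LIMSEQ_le_const) auto
    then show ?thesis by (simp add: N_def)
  qed
qed

theorem theorem1p7:
  "(\<forall>q N :: nat. 2 \<le> q \<and> 2 \<le> N \<longrightarrow>
      (\<exists>(X :: nat set) (Y :: nat set) F.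
         PHF N (N * q ^ (N - 1)) (q ^ (N - 1) + (N - 1) * q ^ (N - 2)) (N + 1) X Y F)) \<and>
   (\<forall>(ws :: nat list) (u :: nat).
      2 \<le> length ws \<and> (\<forall>w\<in>set ws. 0 < w) \<and> u = sum_list ws \<longrightarrow>
      (\<forall>q\<ge>2. real (max_SHF (u - 1) q ws) \<le> (real u - 1) * real q) \<and>
      (\<forall>\<gamma> :: real. (\<forall>q\<ge>2. real (max_SHF (u - 1) q ws) \<le> \<gamma> * real q) \<longrightarrow> real u - 1 \<le> \<gamma>))"
proof (rule conjI)
  show "\<forall>q N :: nat. 2 \<le> q \<and> 2 \<le> N \<longrightarrow>
      (\<exists>(X :: nat set) (Y :: nat set) F.
         PHF N (N * q ^ (N - 1)) (q ^ (N - 1) + (N - 1) * q ^ (N - 2)) (N + 1) X Y F)"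
    using PHF_exists by blast
  show "\<forall>(ws :: nat list) (u :: nat).
      2 \<le> length ws \<and> (\<forall>w\<in>set ws. 0 < w) \<and> u = sum_list ws \<longrightarrow>
      (\<forall>q\<ge>2. real (max_SHF (u - 1) q ws) \<le> (real u - 1) * real q) \<and>
      (\<forall>\<gamma> :: real. (\<forall>q\<ge>2. real (max_SHF (u - 1) q ws) \<le> \<gamma> * real q) \<longrightarrow> real u - 1 \<le> \<gamma>)"
  proof (intro allI impI, elim conjE, intro conjI allI impI)
    fix ws :: "nat list" and u q :: nat
    assume ws: "2 \<le> length ws" "\<forall>w\<in>set ws. 0 < w" and u: "u = sum_list ws" and q: "2 \<le> q"
    \<comment> \<open>Positivity of \<open>u\<close> reconciles truncated subtraction on naturals
      with subtraction on reals.\<close>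
    have "1 \<le> u" using length_le_sum_list[of ws] ws u by simp
    then have "real u - 1 = real (u - 1)" by simp
    moreover have "max_SHF (u - 1) q ws \<le> (u - 1) * q"
      using max_SHF_le[of ws q] ws u q by simp
    ultimately show "real (max_SHF (u - 1) q ws) \<le> (real u - 1) * real q"
      by (metis of_nat_le_iff of_nat_mult)
  next
    fix ws :: "nat list" and u :: nat and \<gamma> :: real
    assume ws: "2 \<le> length ws" "\<forall>w\<in>set ws. 0 < w" and u: "u = sum_list ws"
      and bound: "\<forall>q\<ge>2. real (max_SHF (u - 1) q ws) \<le> \<gamma> * real q"
    have "1 \<le> u" using length_le_sum_list[of ws] ws u by simp
    then have "real u - 1 = real (u - 1)" by simp
    also have "\<dots> \<le> \<gamma>"
      using max_SHF_ratio_ge[of ws \<gamma>] ws u bound by simp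
    finally show "real u - 1 \<le> \<gamma>" .
  qed
qed

end
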